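(* Let $p$ be a prime, let $L,R\ge 1$ be integers, and let $c_{-L},\dots,c_R\in\mathbb{F}_p$ with $c_{-L}\neq 0$ and $c_R\neq 0$. Let $M$ be the $n\times n$ banded Toeplitz matrix with parameters $c_{-L},\dots,c_R$, assume $M$ is invertible, and let $B_{i,j}$ be the blocks of $M^{-1}$ of size $P(f)\times P(f)$. Then for all $1\le i\le\lfloor n/P(f)\rfloor$ one has $B_{i,i}=B_{1,1}$. Moreover, if $P(f)\nmid n$, then $B_{\lceil n/P(f)\rceil,\lceil n/P(f)\rceil}$ is equal to the upper-left $(n\bmod P(f))\times(n\bmod P(f))$ submatrix of $B_{1,1}$.
   Context: The banded Toeplitz matrix $M$ of order $n$ with parameters $c_{-L},\dots,c_R$ is the $n\times n$ matrix whose $(i,j)$ entry is $c_{j-i}$ if $-L\le j-i\le R$ and $0$ otherwise. The associated polynomial is $f(x)=c_R x^{L+R}+\cdots+c_{-L+1}x+c_{-L}\in\mathbb{F}_p[x]$, and its period is $P(f)=\min\{q\in\mathbb{Z}_{>0} : f(x)\mid x^q-1 \text{ in } \mathbb{F}_p[x]\}$. Block partition: starting from the top-left corner, $M^{-1}$ is partitioned into blocks $B_{i,j}$, $1\le i,j\le\lceil n/P(f)\rceil$, of size $P(f)\times P(f)$, where $B_{i,j}$ consists of rows $(i-1)P(f)+1,\dots,\min(iP(f),n)$ and columns $(j-1)P(f)+1,\dots,\min(jP(f),n)$ (so the last block row and column are smaller if $P(f)\nmid n$). *)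

theory Defs
  imports
    "Jordan_Normal_Form.Gauss_Jordan_Elimination"
    "Jordan_Normal_Form.DL_Submatrix"
    "Berlekamp_Zassenhaus.Finite_Field"
begin

text \<open>
  The field \<open>F_p\<close> is the type \<open>'p mod_ring\<close> of residues modulo \<open>p = CARD('p)\<close>, where
  \<open>'p :: prime_card\<close>. A parameter family \<open>c_{-L}, ..., c_R\<close> is a function on \<open>int\<close>, of which
  only the values on \<open>{- L..R}\<close> are ever used. Library matrices are indexed from \<open>0\<close>; this
  does not affect the differences \<open>j - i\<close>.
\<close>

definition banded_toeplitz :: "nat \<Rightarrow> nat \<Rightarrow> nat \<Rightarrow> (int \<Rightarrow> 'a) \<Rightarrow> 'a::zero mat" where
  "banded_toeplitz n L R c =
     mat n n (\<lambda>(i, j). if - int L \<le> int j - int i \<and> int j - int i \<le> int R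
                       then c (int j - int i) else 0)"

definition assoc_poly :: "nat \<Rightarrow> nat \<Rightarrow> (int \<Rightarrow> 'a) \<Rightarrow> 'a::comm_ring_1 poly" where
  "assoc_poly L R c = (\<Sum>k\<le>L + R. monom (c (int k - int L)) k)"

definition poly_period :: "'a::field poly \<Rightarrow> nat" where
  "poly_period f = (LEAST q. q > 0 \<and> f dvd monom 1 q - 1)"

text \<open>
  Block indices \<open>i\<close>, \<open>j\<close> start at \<open>1\<close>, row and column indices at \<open>0\<close>.
\<close>

definition block :: "nat \<Rightarrow> 'a mat \<Rightarrow> nat \<Rightarrow> nat \<Rightarrow> 'a mat" where
  "block P A i j =
     submatrix A {(i - 1) * P..<min (i * P) (dim_row A)} {(j - 1) * P..<min (j * P) (dim_col A)}"

end

theory Submission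
  imports Defs
begin

text \<open>
  Write \<open>f q = x\<^sup>P - 1\<close> and \<open>A = M\<inverse>\<close>. Read as a sequence, a shift of the coefficients of \<open>q\<close> is
  mapped by \<open>M\<close> to the coefficients of \<open>x\<^sup>P - 1\<close>, i.e. to a difference of two unit vectors whose
  indices differ by \<open>P\<close>. Applying \<open>A\<close>, columns \<open>j\<close> and \<open>j + P\<close> of \<open>A\<close> differ by shifted
  coefficients of \<open>q\<close>, and likewise rows \<open>i\<close> and \<open>i + P\<close>. Passing from \<open>(i, j)\<close> to
  \<open>(i + P, j + P)\<close> the two corrections cancel, so \<open>A\<close> is invariant under this shift.
\<close>

section \<open>Banded Toeplitz products as polynomial multiplication\<close>

text \<open>Coefficients extended by zero to negative indices, so that shifted coefficient sequences
  can be written with integer offsets and no truncated subtraction.\<close>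

definition int_coeff :: "'a::zero poly \<Rightarrow> int \<Rightarrow> 'a" where
  "int_coeff p k = (if k < 0 then 0 else coeff p (nat k))"

lemma int_coeff_nonzero_bounds:
  assumes "int_coeff p k \<noteq> 0"
  shows "0 \<le> k" "k \<le> int (degree p)"
  using assms le_degree[of p "nat k"] by (auto simp: int_coeff_def split: if_splits)

text \<open>Outside \<open>{s..t}\<close> one of the two indices is negative, and outside
  \<open>{0..<n}\<close> the terms vanish by \<open>supp\<close>. Hence the sum over matrix indices
  is the full Cauchy product.\<close>

lemma int_coeff_mult:
  fixes p q :: "'a::comm_semiring_0 poly"
  assumes supp: "\<And>k. k < 0 \<or> int n \<le> k \<Longrightarrow> int_coeff p (k - s) * int_coeff q (t - k) = 0"
  shows "(\<Sum>k<n. int_coeff p (int k - s) * int_coeff q (t - int k)) = int_coeff (p * q) (t - s)"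
proof -
  let ?g = "\<lambda>k. int_coeff p (k - s) * int_coeff q (t - k)"
  let ?S = "{0..<int n} \<union> {s..t}"
  have "(\<Sum>k<n. ?g (int k)) = sum ?g {0..<int n}"
    by (rule sum.reindex_bij_witness[of _ nat int]) auto
  also have "\<dots> = sum ?g ?S"
    by (rule sum.mono_neutral_left) (use supp in auto)
  also have "\<dots> = sum ?g {s..t}"
    by (rule sum.mono_neutral_right) (auto simp: int_coeff_def)
  also have "\<dots> = int_coeff (p * q) (t - s)"
  proof (cases "t < s")
    case False
    have "sum ?g {s..t} = (\<Sum>i\<le>nat (t - s). coeff p i * coeff q (nat (t - s) - i))"
      by (rule sum.reindex_bij_witness[of _ "\<lambda>i. s + int i" "\<lambda>k. nat (k - s)"])
        (use False in \<open>auto simp: int_coeff_def intro!: arg_cong2[where f = times] arg_cong[where f = "coeff q"]\<close>)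
    with False show ?thesis
      by (simp add: int_coeff_def coeff_mult)
  qed (simp add: int_coeff_def)
  finally show ?thesis .
qed

lemma int_coeff_monom_minus_1:
  assumes "P > 0"
  shows "int_coeff (monom 1 P - 1 :: 'a::comm_ring_1 poly) k
           = (if k = int P then 1 else 0) - (if k = 0 then 1 else 0)"
  using assms by (auto simp: int_coeff_def)

lemma coeff_assoc_poly:
  "coeff (assoc_poly L R c) k = (if k \<le> L + R then c (int k - int L) else 0)"
  unfolding assoc_poly_def by (simp add: coeff_sum if_distrib cong: if_cong)

lemma degree_assoc_poly:
  assumes "c (int R) \<noteq> 0"
  shows "degree (assoc_poly L R c) = L + R"
  by (rule antisym) (use assms in \<open>auto intro!: degree_le le_degree simp: coeff_assoc_poly\<close>)

text \<open>The offset \<open>L\<close> moves the band to the exponents from 0 to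
  \<open>L + R\<close>, and the zeros outside the band become vanishing coefficients.\<close>

lemma banded_toeplitz_index:
  assumes "i < n" "j < n"
  shows "banded_toeplitz n L R c $$ (i, j) = int_coeff (assoc_poly L R c) (int j - int i + int L)"
  using assms by (auto simp: banded_toeplitz_def int_coeff_def coeff_assoc_poly)

section \<open>Existence of the period\<close>

text \<open>The constant coefficient of \<open>f\<close> is a nonzero field-like element without
  zero divisors, so the cofactor must have constant coefficient 0 and a factor x cancels on both
  sides.\<close>

lemma dvd_pCons_0_cancel:
  fixes f :: "'a::idom poly"
  assumes "coeff f 0 \<noteq> 0" and "f dvd pCons 0 p"
  shows "f dvd p"
proof -
  from assms(2) obtain g where g: "pCons 0 p = f * g" by (auto simp: dvd_def)
  obtain a g' where g': "g = pCons a g'" by (cases g)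
  have "coeff (f * g) 0 = 0" by (simp flip: g)
  with assms(1) have "a = 0" by (simp add: coeff_mult g')
  with g g' have "p = f * g'" by simp
  then show ?thesis by simp
qed

lemma dvd_monom_mult_cancel:
  fixes f :: "'a::idom poly"
  assumes "coeff f 0 \<noteq> 0" and "f dvd monom 1 k * p"
  shows "f dvd p"
  using assms(2)
proof (induction k)
  case (Suc k)
  have "f dvd pCons 0 (monom 1 k * p)"
    using Suc.prems by (simp add: monom_Suc)
  from Suc.IH[OF dvd_pCons_0_cancel[OF assms(1) this]] show ?case .
qed (simp add: monom_0)

lemma finite_degree_le: "finite {p :: 'a::{zero,finite} poly. degree p \<le> d}"
proof (rule finite_surj)
  show "finite {xs :: 'a list. set xs \<subseteq> UNIV \<and> length xs \<le> Suc d}"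
    by (rule finite_lists_length_le) simp
  show "{p :: 'a poly. degree p \<le> d} \<subseteq> Poly ` {xs. set xs \<subseteq> UNIV \<and> length xs \<le> Suc d}"
  proof
    fix p :: "'a poly"
    assume "p \<in> {p. degree p \<le> d}"
    then have "length (coeffs p) \<le> Suc d"
      by (cases "p = 0") (auto simp: length_coeffs)
    then show "p \<in> Poly ` {xs. set xs \<subseteq> UNIV \<and> length xs \<le> Suc d}"
      by (intro image_eqI[of _ _ "coeffs p"]) auto
  qed
qed

text \<open>Pigeonhole: there are finitely many remainders modulo \<open>f\<close>, so two powers of
  x agree modulo \<open>f\<close>. The lower power cancels because \<open>f\<close> has nonzero
  constant term.\<close>

lemma ex_dvd_monom_minus_1:
  fixes f :: "'a::{field,finite} poly"
  assumes "coeff f 0 \<noteq> 0"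
  shows "\<exists>q>0. f dvd monom 1 q - 1"
proof -
  let ?r = "\<lambda>k::nat. monom 1 k mod f"
  have "degree (?r k) \<le> degree f" for k
    using degree_mod_less[of f "monom 1 k"] assms by force
  then have "finite (range ?r)"
    by (intro finite_subset[OF _ finite_degree_le[of "degree f"]]) auto
  then have "\<not> inj ?r"
    using finite_imageD infinite_UNIV_nat by blast
  then obtain a b where ab: "?r a = ?r b" "a < b"
    unfolding inj_def by (metis nat_neq_iff)
  have "f dvd monom 1 b - monom 1 a"
    using ab(1) by (simp flip: mod_eq_dvd_iff)
  also have "monom 1 b - monom 1 a = monom 1 a * (monom 1 (b - a) - (1 :: 'a poly))"
    using ab(2) by (simp add: right_diff_distrib mult_monom)
  finally have "f dvd monom 1 (b - a) - 1"
    using assms dvd_monom_mult_cancel by blast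
  with ab(2) show ?thesis by (intro exI[of _ "b - a"]) simp
qed

lemma poly_period:
  fixes f :: "'a::{field,finite} poly"
  assumes "coeff f 0 \<noteq> 0"
  shows "poly_period f > 0" "f dvd monom 1 (poly_period f) - 1"
  using LeastI_ex[OF ex_dvd_monom_minus_1[OF assms]] unfolding poly_period_def by auto

section \<open>Periodicity of the inverse along diagonals\<close>

lemma mat_mult_index_eq_sum:
  assumes "A \<in> carrier_mat n n" "B \<in> carrier_mat n n" "i < n" "j < n"
  shows "(A * B) $$ (i, j) = (\<Sum>k<n. A $$ (i, k) * B $$ (k, j))"
  using assms by (simp add: scalar_prod_def lessThan_atLeast0)

locale toeplitz_inverse =
  fixes n L R P :: nat and c :: "int \<Rightarrow> 'a::field" and q :: "'a poly" and A :: "'a mat"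
  assumes LR: "L \<ge> 1" "R \<ge> 1" and nz: "c (int R) \<noteq> 0"
    and P: "P > 0" and q: "assoc_poly L R c * q = monom 1 P - 1"
    and A: "A \<in> carrier_mat n n"
    and left: "A * banded_toeplitz n L R c = 1\<^sub>m n"
    and right: "banded_toeplitz n L R c * A = 1\<^sub>m n"
begin

abbreviation M where "M \<equiv> banded_toeplitz n L R c"

lemma M: "M \<in> carrier_mat n n"
  by (simp add: banded_toeplitz_def)

lemma sum_left: "i < n \<Longrightarrow> j < n \<Longrightarrow> (\<Sum>k<n. A $$ (i, k) * M $$ (k, j)) = (if i = j then 1 else 0)"
  using mat_mult_index_eq_sum[OF A M, of i j] left by simp

lemma sum_right: "i < n \<Longrightarrow> j < n \<Longrightarrow> (\<Sum>k<n. M $$ (i, k) * A $$ (k, j)) = (if i = j then 1 else 0)"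
  using mat_mult_index_eq_sum[OF M A, of i j] right by simp

text \<open>Comparison of degrees in the factorization \<open>q\<close>. It bounds the support of
  the shifted coefficient vectors, which therefore fit into the index range of the matrix.\<close>

lemma degree_q: "degree q + L + R = P"
proof -
  let ?f = "assoc_poly L R c"
  have deg: "degree (monom 1 P - 1 :: 'a poly) = P"
    using P by (intro antisym degree_le le_degree) auto
  then have "?f * q \<noteq> 0" using q P by auto
  then have "?f \<noteq> 0" "q \<noteq> 0" by auto
  then have "degree (?f * q) = (L + R) + degree q"
    by (simp add: degree_mult_eq degree_assoc_poly[where c = c, OF nz])
  with deg q show ?thesis by simp
qed

lemma toeplitz_mult_shift:
  assumes "i < n" "j + P < n"
  shows "(\<Sum>k<n. M $$ (i, k) * int_coeff q (int P - int L + int j - int k))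
           = (if i = j then 1 else 0) - (if i = j + P then 1 else 0)"
proof -
  let ?f = "assoc_poly L R c" and ?s = "int i - int L" and ?t = "int P - int L + int j"
  have "(\<Sum>k<n. M $$ (i, k) * int_coeff q (?t - int k))
          = (\<Sum>k<n. int_coeff ?f (int k - ?s) * int_coeff q (?t - int k))"
    by (intro sum.cong) (auto simp: banded_toeplitz_index assms(1) algebra_simps)
  also have "\<dots> = int_coeff (?f * q) (?t - ?s)"
  proof (rule int_coeff_mult)
    fix k assume k: "k < 0 \<or> int n \<le> k"
    \<comment> \<open>By \<open>degree_q\<close>, a nonzero coefficient forces j + R \<le> k \<le> j
      + P - L, which lies inside the matrix since j + P < n.\<close>
    have "int_coeff q (?t - k) = 0"
      using int_coeff_nonzero_bounds[of q "?t - k"] k degree_q assms by linarith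
    then show "int_coeff ?f (k - ?s) * int_coeff q (?t - k) = 0" by simp
  qed
  also have "\<dots> = (if i = j then 1 else 0) - (if i = j + P then 1 else 0)"
    unfolding q int_coeff_monom_minus_1[OF P] by auto
  finally show ?thesis .
qed

lemma shift_mult_toeplitz:
  assumes "i + P < n" "j < n"
  shows "(\<Sum>k<n. int_coeff q (int k - (int L + int i)) * M $$ (k, j))
           = (if i + P = j then 1 else 0) - (if i = j then 1 else 0)"
proof -
  let ?f = "assoc_poly L R c" and ?s = "int L + int i" and ?t = "int j + int L"
  have "(\<Sum>k<n. int_coeff q (int k - ?s) * M $$ (k, j))
          = (\<Sum>k<n. int_coeff q (int k - ?s) * int_coeff ?f (?t - int k))"
    by (intro sum.cong) (auto simp: banded_toeplitz_index assms(2) algebra_simps)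
  also have "\<dots> = int_coeff (q * ?f) (?t - ?s)"
  proof (rule int_coeff_mult)
    fix k assume k: "k < 0 \<or> int n \<le> k"
    \<comment> \<open>Here the support is i + L \<le> k \<le> i + P - R, inside the matrix since i +
      P < n.\<close>
    have "int_coeff q (k - ?s) = 0"
      using int_coeff_nonzero_bounds[of q "k - ?s"] k degree_q assms by linarith
    then show "int_coeff q (k - ?s) * int_coeff ?f (?t - k) = 0" by simp
  qed
  also have "\<dots> = (if i + P = j then 1 else 0) - (if i = j then 1 else 0)"
    unfolding mult.commute[of q] q int_coeff_monom_minus_1[OF P] by auto
  finally show ?thesis .
qed

text \<open>With e denoting unit vectors, \<open>toeplitz_mult_shift\<close> reads M v = e_j -
  e_(j+P). Multiplication by \<open>A\<close> from the left, using A M = 1, turns this into v = A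
  e_j - A e_(j+P).\<close>

lemma inverse_column_shift:
  assumes "i < n" "j + P < n"
  shows "A $$ (i, j + P) = A $$ (i, j) - int_coeff q (int P - int L + int j - int i)"
proof -
  let ?v = "\<lambda>k. int_coeff q (int P - int L + int j - int k)"
  have "A $$ (i, j) - A $$ (i, j + P)
      = (\<Sum>l<n. A $$ (i, l) * ((if l = j then 1 else 0) - (if l = j + P then 1 else 0)))"
    using assms by (simp add: right_diff_distrib sum_subtractf if_distrib[of "\<lambda>x. _ * x"] cong: if_cong)
  also have "\<dots> = (\<Sum>l<n. A $$ (i, l) * (\<Sum>k<n. M $$ (l, k) * ?v k))"
    using assms by (intro sum.cong) (simp_all add: toeplitz_mult_shift)
  also have "\<dots> = (\<Sum>l<n. \<Sum>k<n. A $$ (i, l) * M $$ (l, k) * ?v k)"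
    by (simp add: sum_distrib_left mult.assoc)
  also have "\<dots> = (\<Sum>k<n. (\<Sum>l<n. A $$ (i, l) * M $$ (l, k)) * ?v k)"
    by (subst sum.swap) (simp add: sum_distrib_right)
  also have "\<dots> = ?v i"
    using assms(1) by (simp add: sum_left if_distrib[of "\<lambda>x. x * _"] cong: if_cong)
  finally show ?thesis by (simp add: algebra_simps)
qed

text \<open>The transposed argument: the row identity \<open>shift_mult_toeplitz\<close> is
  multiplied by \<open>A\<close> from the right, using M A = 1.\<close>

lemma inverse_row_shift:
  assumes "i + P < n" "j < n"
  shows "A $$ (i + P, j) = A $$ (i, j) + int_coeff q (int j - (int L + int i))"
proof -
  let ?w = "\<lambda>k. int_coeff q (int k - (int L + int i))"
  have "A $$ (i + P, j) - A $$ (i, j)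
      = (\<Sum>l<n. ((if i + P = l then 1 else 0) - (if i = l then 1 else 0)) * A $$ (l, j))"
    using assms by (simp add: left_diff_distrib sum_subtractf if_distrib[of "\<lambda>x. x * _"] cong: if_cong)
  also have "\<dots> = (\<Sum>l<n. (\<Sum>k<n. ?w k * M $$ (k, l)) * A $$ (l, j))"
    using assms by (intro sum.cong) (simp_all add: shift_mult_toeplitz)
  also have "\<dots> = (\<Sum>l<n. \<Sum>k<n. ?w k * (M $$ (k, l) * A $$ (l, j)))"
    by (simp add: sum_distrib_right mult.assoc)
  also have "\<dots> = (\<Sum>k<n. ?w k * (\<Sum>l<n. M $$ (k, l) * A $$ (l, j)))"
    by (subst sum.swap) (simp add: sum_distrib_left)
  also have "\<dots> = ?w j"
    using assms(2) by (simp add: sum_right if_distrib cong: if_cong)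
  finally show ?thesis by (simp add: algebra_simps)
qed

lemma inverse_shift:
  assumes "i + P < n" "j + P < n"
  shows "A $$ (i + P, j + P) = A $$ (i, j)"
  \<comment> \<open>The path goes through (i + P, j). In row i + P the column correction has index j
    - i - L, the same as the row correction.\<close>
  using inverse_column_shift[OF assms] inverse_row_shift[of i j] assms
  by (simp add: algebra_simps)

lemma inverse_periodic:
  assumes "k * P + i < n" "k * P + j < n"
  shows "A $$ (k * P + i, k * P + j) = A $$ (i, j)"
  using assms
proof (induction k)
  case (Suc k)
  then show ?case
    using inverse_shift[of "k * P + i" "k * P + j"] by (simp add: algebra_simps)
qed simp

end

section \<open>Blocks as index windows\<close>

lemma pick_atLeastLessThan:
  assumes "i < b - a"
  shows "pick {a..<b} i = a + i"
proof -
  have "{x \<in> {a..<b}. x < a + i} = {a..<a + i}" using assms by auto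
  moreover have "pick {a..<b} (card {x \<in> {a..<b}. x < a + i}) = a + i"
    by (rule pick_card_in_set) (use assms in auto)
  ultimately show ?thesis by simp
qed

lemma submatrix_intervals:
  assumes "b \<le> dim_row A" "d \<le> dim_col A"
  shows "submatrix A {a..<b} {e..<d} = mat (b - a) (d - e) (\<lambda>(i, j). A $$ (a + i, e + j))"
proof -
  have "{i. i < dim_row A \<and> i \<in> {a..<b}} = {a..<b}"
    "{j. j < dim_col A \<and> j \<in> {e..<d}} = {e..<d}" using assms by auto
  then show ?thesis
    unfolding submatrix_def by (intro eq_matI) (simp_all add: pick_atLeastLessThan)
qed

text \<open>Writing the block index as \<open>Suc k\<close> removes the truncated subtraction in
  \<open>block\<close>.\<close>

lemma block_diagonal:
  assumes "A \<in> carrier_mat n n"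
  shows "block P A (Suc k) (Suc k)
    = mat (min (Suc k * P) n - k * P) (min (Suc k * P) n - k * P) (\<lambda>(i, j). A $$ (k * P + i, k * P + j))"
  using assms unfolding block_def by (subst submatrix_intervals) auto

lemma nat_ceiling_divide:
  assumes "P > 0" "\<not> P dvd n"
  shows "nat \<lceil>real n / real P\<rceil> = Suc (n div P)"
proof -
  have "real n = real (n div P) * real P + real (n mod P)"
    by (metis div_mult_mod_eq of_nat_add of_nat_mult)
  moreover have "0 < n mod P" "n mod P < P" using assms by (auto simp: mod_greater_zero_iff_not_dvd)
  ultimately have "\<lceil>real n / real P\<rceil> = int (Suc (n div P))"
    using assms by (intro ceiling_unique) (auto simp: field_simps)
  then show ?thesis by simp
qed

lemma invertible_mat_inverse:
  fixes M :: "'a::field mat"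
  assumes M: "M \<in> carrier_mat n n" and inv: "invertible_mat M"
  shows "M * the (mat_inverse M) = 1\<^sub>m n" "the (mat_inverse M) * M = 1\<^sub>m n"
    "the (mat_inverse M) \<in> carrier_mat n n"
proof -
  from inv obtain B where B: "M * B = 1\<^sub>m (dim_row M)" "B * M = 1\<^sub>m (dim_row B)"
    by (auto simp: invertible_mat_def inverts_mat_def)
  \<comment> \<open>\<open>invertible_mat\<close> does not state the size of \<open>B\<close>; the
    column counts of the two products determine it.\<close>
  from arg_cong[OF B(1), of dim_col] arg_cong[OF B(2), of dim_col] M
  have "B \<in> carrier_mat n n" by auto
  with B M have "M \<in> Units (ring_mat TYPE('a) n undefined)"
    by (auto simp: Units_def ring_mat_simps)
  then obtain A where "mat_inverse M = Some A"
    using mat_inverse(1)[OF M, where b = undefined] by (cases "mat_inverse M") auto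
  with mat_inverse(2)[OF M this]
  show "M * the (mat_inverse M) = 1\<^sub>m n" "the (mat_inverse M) * M = 1\<^sub>m n"
    "the (mat_inverse M) \<in> carrier_mat n n" by auto
qed

section \<open>Comparison of the diagonal blocks\<close>

theorem theorem10:
  fixes L R n :: nat and c :: "int \<Rightarrow> 'p::prime_card mod_ring"
    and M :: "'p mod_ring mat" and P :: nat and B :: "nat \<Rightarrow> nat \<Rightarrow> 'p mod_ring mat"
  assumes "L \<ge> 1" and "R \<ge> 1"
    and "c (- int L) \<noteq> 0" and "c (int R) \<noteq> 0"
    and M: "M = banded_toeplitz n L R c"
    and "invertible_mat M"
    and P: "P = poly_period (assoc_poly L R c)"
    and B: "\<And>i j. B i j = block P (the (mat_inverse M)) i j"
  shows "(\<forall>i. 1 \<le> i \<and> i \<le> n div P \<longrightarrow> B i i = B 1 1) \<and>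
    (\<not> P dvd n \<longrightarrow>
      B (nat \<lceil>real n / real P\<rceil>) (nat \<lceil>real n / real P\<rceil>)
        = submatrix (B 1 1) {..<n mod P} {..<n mod P})"
proof -
  define A where "A = the (mat_inverse M)"
  have "M \<in> carrier_mat n n" by (simp add: M banded_toeplitz_def)
  note inv = invertible_mat_inverse[OF this \<open>invertible_mat M\<close>, folded A_def]
  have "coeff (assoc_poly L R c) 0 \<noteq> 0"
    using \<open>c (- int L) \<noteq> 0\<close> by (simp add: coeff_assoc_poly)
  note period = poly_period[OF this, folded P]
  from period(2) obtain q where q: "assoc_poly L R c * q = monom 1 P - 1"
    by (metis dvd_def)
  interpret toeplitz_inverse n L R P c q A
    using assms inv period(1) q by unfold_locales (auto simp: M)
  note blk = B[folded A_def, unfolded One_nat_def]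
  \<comment> \<open>The minimum covers n < P, where the first block is all of
    \<open>A\<close>.\<close>
  have B1: "B 1 1 = mat (min P n) (min P n) (\<lambda>(i, j). A $$ (i, j))"
    using block_diagonal[OF inv(3), of P 0] by (simp add: blk)
  show ?thesis
  proof (intro conjI allI impI)
    fix i assume i: "1 \<le> i \<and> i \<le> n div P"
    then obtain k where k: "i = Suc k" by (cases i) auto
    \<comment> \<open>The block is therefore full, of size P, and so is
      \<open>B 1 1\<close>.\<close>
    have "Suc k * P \<le> n"
      using i k by (metis div_times_less_eq_dividend order_trans mult_le_mono1)
    then show "B i i = B 1 1"
      unfolding B1 unfolding k blk block_diagonal[OF inv(3)]
      by (intro eq_matI) (auto simp: inverse_periodic)
  next
    assume ndvd: "\<not> P dvd n"
    let ?k = "n div P" and ?m = "n mod P"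
    have n: "?k * P + ?m = n" by simp
    have lt: "?k * P + i < n" if "i < ?m" for i
      using n that by linarith
    have m: "?m < P" "?m \<le> n" using period(1) by auto
    \<comment> \<open>The last block is cut off by the matrix border, which leaves n mod P rows and
      columns.\<close>
    have "n \<le> Suc ?k * P"
      using m n unfolding mult_Suc by linarith
    then have "min (Suc ?k * P) n - ?k * P = ?m"
      by (simp only: min_absorb2 minus_div_mult_eq_mod)
    then have "B (Suc ?k) (Suc ?k) = mat ?m ?m (\<lambda>(i, j). A $$ (?k * P + i, ?k * P + j))"
      unfolding blk block_diagonal[OF inv(3)] by simp
    also have "\<dots> = mat ?m ?m (\<lambda>(i, j). A $$ (i, j))"
      by (intro eq_matI) (auto intro!: inverse_periodic lt)
    also have "\<dots> = submatrix (B 1 1) {..<?m} {..<?m}"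
      unfolding lessThan_atLeast0 B1 using m less_le_trans[OF _ m(2)]
      by (subst submatrix_intervals) (auto intro!: eq_matI)
    finally show "B (nat \<lceil>real n / real P\<rceil>) (nat \<lceil>real n / real P\<rceil>)
        = submatrix (B 1 1) {..<n mod P} {..<n mod P}"
      by (simp add: nat_ceiling_divide[OF period(1) ndvd])
  qed
qed

end
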